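(* Consider the star-game with Minimizer responding (and Maximizer initiating). If $G$ is a graph with $\mu(G)=m$, then the value of the game is at least $\lceil m/3\rceil$, and this is sharp.
   Context: $P_3$ is the path on three vertices; copies of $P_3$ in a graph are subgraphs, not necessarily induced. A $P_3$-packing of $G$ is a collection of vertex-disjoint copies of $P_3$ in $G$, and $\mu(G)$ is the maximum size (number of copies) of a $P_3$-packing of $G$. The star-game on $G$ is played by two players, Maximizer and Minimizer; throughout the game one of them is the initiator and the other is the responder. In each round, the initiator chooses a vertex $v$ of the current graph such that the current graph contains at least one copy of $P_3$ with $v$ as its center vertex (degree-2 vertex of the path); the responder then chooses one copy of $P_3$ in the current graph with $v$ as its center; the three vertices of that copy are removed, and the next round is played on the subgraph induced by the remaining vertices. The game ends when the remaining graph contains no copy of $P_3$. Maximizer tries to maximize, and Minimizer tries to minimize, the number of copies of $P_3$ taken. The value of the game is the number of copies taken under optimal play by both players. *)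

theory Defs
  imports Complex_Main "Graph_Theory.Digraph_Component"
begin

text \<open>
  Finite simple graphs are the graphs of the library locale \<^const>\<open>graph\<close>: finite symmetric
  digraphs without loops and parallel arcs, each undirected edge being a pair of opposite arcs.

  A copy of the path on three vertices is determined by its center and the unordered pair of its
  endpoints, and it is represented by this pair. The endpoints may be adjacent in \<open>G\<close>, so the
  copy need not be induced; in particular a triangle contains three different copies.
\<close>

type_synonym 'a p3 = "'a \<times> 'a set"

definition p3_at :: "('a, 'b) pre_digraph \<Rightarrow> 'a \<Rightarrow> 'a p3 set" where
  "p3_at G v = {(v, L) | L. L \<subseteq> {w. v \<rightarrow>\<^bsub>G\<^esub> w} \<and> card L = 2}"

definition p3_copies :: "('a, 'b) pre_digraph \<Rightarrow> 'a p3 set" where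
  "p3_copies G = (\<Union>v\<in>verts G. p3_at G v)"

definition p3_verts :: "'a p3 \<Rightarrow> 'a set" where
  "p3_verts c = insert (fst c) (snd c)"

definition p3_packing :: "('a, 'b) pre_digraph \<Rightarrow> 'a p3 set \<Rightarrow> bool" where
  "p3_packing G P \<longleftrightarrow>
    P \<subseteq> p3_copies G \<and> pairwise (\<lambda>c d. disjnt (p3_verts c) (p3_verts d)) P"

definition p3_packing_number :: "('a, 'b) pre_digraph \<Rightarrow> nat" where
  "p3_packing_number G = Max {card P | P. p3_packing G P}"

definition p3_centers :: "('a, 'b) pre_digraph \<Rightarrow> 'a set" where
  "p3_centers G = {v \<in> verts G. p3_at G v \<noteq> {}}"

definition remove_p3 :: "('a, 'b) pre_digraph \<Rightarrow> 'a p3 \<Rightarrow> ('a, 'b) pre_digraph" where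
  "remove_p3 G c = G \<restriction> (verts G - p3_verts c)"

lemma graph_remove_p3:
  assumes "graph G"
  shows "graph (remove_p3 G c)"
proof -
  interpret graph G by (rule assms)
  let ?H = "remove_p3 G c"
  have wf: "wf_digraph ?H"
    unfolding remove_p3_def by (rule wellformed_induce_subgraph)
  have fin: "finite (verts ?H)" "finite (arcs ?H)"
    by (simp_all add: remove_p3_def)
  have loop: "tail ?H e \<noteq> head ?H e" if "e \<in> arcs ?H" for e
    using that no_loops by (auto simp: remove_p3_def)
  have multi: "e1 = e2"
    if "e1 \<in> arcs ?H" "e2 \<in> arcs ?H" "arc_to_ends ?H e1 = arc_to_ends ?H e2" for e1 e2
    using that no_multi_arcs by (auto simp: remove_p3_def)
  have symm: "symmetric ?H"
    using sym_arcs unfolding symmetric_conv by (fastforce simp: remove_p3_def)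
  show ?thesis
    using wf fin loop multi symm
    by (intro graph.intro digraph.intro pseudo_graph.intro fin_digraph.intro
        loopfree_digraph.intro nomulti_digraph.intro sym_digraph.intro
        fin_digraph_axioms.intro loopfree_digraph_axioms.intro nomulti_digraph_axioms.intro
        sym_digraph_axioms.intro) auto
qed

text \<open>
  The minimax value of the star-game in which Maximizer initiates, that is, chooses the center
  \<open>v\<close>, and Minimizer responds, that is, chooses a copy with this center. The test
  \<^prop>\<open>graph G\<close> is preserved by the moves and serves termination only; the value of anything
  that is not a finite simple graph is irrelevant.
\<close>

function star_game_value :: "('a, 'b) pre_digraph \<Rightarrow> nat" where
  "star_game_value G =
    (if graph G \<and> p3_centers G \<noteq> {}
     then MAX v \<in> p3_centers G. MIN c \<in> p3_at G v. Suc (star_game_value (remove_p3 G c))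
     else 0)"
  by auto

termination
proof (relation "measure (\<lambda>G. card (verts G))")
  fix G :: "('a, 'b) pre_digraph" and v c
  assume "graph G \<and> p3_centers G \<noteq> {}" and v: "v \<in> p3_centers G" and c: "c \<in> p3_at G v"
  then interpret graph G by simp
  have "verts (remove_p3 G c) \<subset> verts G"
    using v c by (auto simp: remove_p3_def p3_verts_def p3_centers_def p3_at_def)
  then show "(remove_p3 G c, G) \<in> measure (\<lambda>G. card (verts G))"
    by (simp add: psubset_card_mono)
qed simp

declare star_game_value.simps [simp del]

end

theory Submission
  imports Defs
begin

text \<open>
  Lower bound: a round deletes three vertices, and each of them lies in at most one copy of any
  fixed packing. A round therefore lowers the packing number by at most three
  (\<open>p3_packing_number_remove_p3\<close>), however the two players move. The game goes on as long as
  the packing number is positive, so it lasts at least \<open>m / 3\<close> rounds.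

  Sharpness: take a clique of \<open>m\<close> hubs and hang two pendant leaves on every hub. The leaves have
  degree one, so every copy is centered at a hub. Hence disjoint copies have different hubs as
  centers, and the \<open>m\<close> stars formed by a hub and its leaves are a largest packing. Whichever hub
  Maximizer picks, Minimizer answers with two further hubs as long as there are some, and so
  destroys three hubs per round. What remains is again a graph in which all centers belong to one
  clique, which makes induction possible (\<open>star_game_value_le_clique\<close>).
\<close>

section \<open>Copies and packings after a round\<close>

lemma dominates_remove_p3:
  assumes "graph G"
  shows "u \<rightarrow>\<^bsub>remove_p3 G c\<^esub> w \<longleftrightarrow> u \<rightarrow>\<^bsub>G\<^esub> w \<and> u \<notin> p3_verts c \<and> w \<notin> p3_verts c"
proof -
  interpret graph G by (rule assms)
  show ?thesis
    by (auto simp: remove_p3_def arcs_ends_def arc_to_ends_def image_iff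
        intro: head_in_verts tail_in_verts)
qed

lemma verts_remove_p3: "verts (remove_p3 G c) = verts G - p3_verts c"
  by (simp add: remove_p3_def)

lemma finite_out_neighbours:
  assumes "graph G"
  shows "finite {w. v \<rightarrow>\<^bsub>G\<^esub> w}"
proof -
  interpret graph G by (rule assms)
  have "{w. v \<rightarrow>\<^bsub>G\<^esub> w} \<subseteq> verts G"
    by auto
  then show ?thesis
    by (rule finite_subset) simp
qed

lemma finite_p3_at:
  assumes "graph G"
  shows "finite (p3_at G v)"
proof -
  have "p3_at G v \<subseteq> {v} \<times> Pow {w. v \<rightarrow>\<^bsub>G\<^esub> w}"
    by (auto simp: p3_at_def)
  then show ?thesis
    by (rule finite_subset) (simp add: finite_out_neighbours[OF assms])
qed

lemma finite_p3_centers: "graph G \<Longrightarrow> finite (p3_centers G)"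
  by (simp add: p3_centers_def graph_def digraph_def fin_digraph.finite_verts)

lemma finite_p3_copies:
  assumes "graph G"
  shows "finite (p3_copies G)"
proof -
  interpret graph G by (rule assms)
  show ?thesis
    by (simp add: p3_copies_def finite_p3_at[OF assms])
qed

lemma p3_packingD:
  assumes "p3_packing G P" "c \<in> P" "d \<in> P" "x \<in> p3_verts c" "x \<in> p3_verts d"
  shows "c = d"
  using assms by (auto simp: p3_packing_def pairwise_def disjnt_iff)

lemma finite_p3_packing: "graph G \<Longrightarrow> p3_packing G P \<Longrightarrow> finite P"
  using finite_p3_copies finite_subset by (auto simp: p3_packing_def)

lemma finite_p3_packing_cards:
  assumes "graph G"
  shows "finite {card P | P. p3_packing G P}"
proof -
  have "{card P | P. p3_packing G P} \<subseteq> card ` Pow (p3_copies G)"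
    by (auto simp: p3_packing_def)
  then show ?thesis
    by (rule finite_subset) (simp add: finite_p3_copies[OF assms])
qed

lemma card_le_p3_packing_number:
  assumes "graph G" "p3_packing G P"
  shows "card P \<le> p3_packing_number G"
  unfolding p3_packing_number_def
  using assms by (intro Max_ge finite_p3_packing_cards) auto

lemma p3_packing_number_attained:
  assumes "graph G"
  obtains P where "p3_packing G P" "card P = p3_packing_number G"
proof -
  have "p3_packing G {}"
    by (simp add: p3_packing_def)
  then have "p3_packing_number G \<in> {card P | P. p3_packing G P}"
    unfolding p3_packing_number_def
    by (intro Max_in finite_p3_packing_cards[OF assms]) auto
  then show thesis
    using that by auto
qed

lemma p3_verts_atD:
  assumes "c \<in> p3_at G v"
  shows "finite (p3_verts c)" "card (p3_verts c) \<le> 3"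
proof -
  have "card (snd c) = 2"
    using assms by (auto simp: p3_at_def)
  then show "finite (p3_verts c)" "card (p3_verts c) \<le> 3"
    using card_insert_le_m1[of 3 "snd c" "fst c"]
    by (auto simp: p3_verts_def intro: card_ge_0_finite)
qed

lemma p3_copies_remove_p3I:
  assumes "graph G" "d \<in> p3_copies G" "disjnt (p3_verts c) (p3_verts d)"
  shows "d \<in> p3_copies (remove_p3 G c)"
  using assms(2,3)
  by (auto simp: p3_copies_def p3_at_def p3_verts_def[of d] verts_remove_p3
      dominates_remove_p3[OF assms(1)] disjnt_iff)

lemma p3_centers_remove_p3:
  assumes "graph G"
  shows "p3_centers (remove_p3 G c) \<subseteq> p3_centers G - p3_verts c"
proof -
  have "p3_at (remove_p3 G c) v \<subseteq> p3_at G v" for v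
    by (auto simp: p3_at_def dominates_remove_p3[OF assms])
  then show ?thesis
    unfolding p3_centers_def verts_remove_p3 by blast
qed

text \<open>
  The copies of a packing that meet the removed copy \<open>c\<close> are pairwise disjoint, so they are at
  most as many as the vertices of \<open>c\<close>. The others survive.
\<close>

lemma p3_packing_number_remove_p3:
  assumes G: "graph G" and c: "c \<in> p3_at G v"
  shows "p3_packing_number G \<le> p3_packing_number (remove_p3 G c) + 3"
proof -
  obtain P where P: "p3_packing G P" and card_P: "card P = p3_packing_number G"
    using p3_packing_number_attained[OF G] .
  define Q where "Q = {d \<in> P. disjnt (p3_verts c) (p3_verts d)}"
  have "finite P"
    using finite_p3_packing[OF G P] .
  have "Q \<subseteq> p3_copies (remove_p3 G c)"
  proof
    fix d assume "d \<in> Q"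
    then show "d \<in> p3_copies (remove_p3 G c)"
      using P by (intro p3_copies_remove_p3I[OF G]) (auto simp: p3_packing_def Q_def)
  qed
  then have "p3_packing (remove_p3 G c) Q"
    using P by (simp add: p3_packing_def Q_def pairwise_def)
  then have Q: "card Q \<le> p3_packing_number (remove_p3 G c)"
    by (rule card_le_p3_packing_number[OF graph_remove_p3[OF G]])
  have "\<forall>d \<in> P - Q. \<exists>x. x \<in> p3_verts c \<and> x \<in> p3_verts d"
    by (auto simp: Q_def disjnt_iff)
  then obtain f where f: "\<And>d. d \<in> P - Q \<Longrightarrow> f d \<in> p3_verts c \<and> f d \<in> p3_verts d"
    by metis
  have "inj_on f (P - Q)"
  proof (rule inj_onI)
    fix d e assume "d \<in> P - Q" "e \<in> P - Q" "f d = f e"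
    then show "d = e"
      using f[of d] f[of e] by (intro p3_packingD[OF P, of d e "f d"]) simp_all
  qed
  then have "card (P - Q) \<le> card (p3_verts c)"
    using f p3_verts_atD(1)[OF c] by (intro card_inj_on_le) auto
  also have "\<dots> \<le> 3"
    using p3_verts_atD(2)[OF c] .
  finally have "card P \<le> card Q + 3"
    using \<open>finite P\<close> by (simp add: card_Diff_subset Q_def)
  then show ?thesis
    using Q card_P by simp
qed

section \<open>The lower bound\<close>

lemma star_game_value_no_centers:
  "p3_centers G = {} \<Longrightarrow> star_game_value G = 0"
  by (simp add: star_game_value.simps)

lemma star_game_value_geI:
  assumes "graph G" "v \<in> p3_centers G"
    "\<And>c. c \<in> p3_at G v \<Longrightarrow> k \<le> Suc (star_game_value (remove_p3 G c))"
  shows "k \<le> star_game_value G"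
proof -
  have "k \<le> (MIN c \<in> p3_at G v. Suc (star_game_value (remove_p3 G c)))"
    using assms by (intro Min.boundedI) (auto simp: finite_p3_at p3_centers_def)
  also have "\<dots> \<le> star_game_value G"
    using assms(1,2)
    by (subst (2) star_game_value.simps) (auto intro!: Max_ge simp: finite_p3_centers)
  finally show ?thesis .
qed

lemma star_game_value_leI:
  assumes "graph G"
    "\<And>v. v \<in> p3_centers G \<Longrightarrow> \<exists>c \<in> p3_at G v. Suc (star_game_value (remove_p3 G c)) \<le> k"
  shows "star_game_value G \<le> k"
proof (cases "p3_centers G = {}")
  case False
  have "(MIN c \<in> p3_at G v. Suc (star_game_value (remove_p3 G c))) \<le> k"
    if "v \<in> p3_centers G" for v
    using assms(2)[OF that] finite_p3_at[OF assms(1)]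
    by (meson Min_le finite_imageI image_eqI order_trans)
  then have "(MAX v \<in> p3_centers G. MIN c \<in> p3_at G v. Suc (star_game_value (remove_p3 G c))) \<le> k"
    using False by (intro Max.boundedI) (auto simp: finite_p3_centers[OF assms(1)])
  then show ?thesis
    using False assms(1) by (subst star_game_value.simps) simp
qed (simp add: star_game_value_no_centers)

lemma p3_packing_number_no_centers:
  assumes "graph G" "p3_centers G = {}"
  shows "p3_packing_number G = 0"
proof -
  have "p3_copies G = {}"
    using assms(2) by (auto simp: p3_copies_def p3_centers_def)
  then show ?thesis
    using p3_packing_number_attained[OF assms(1)]
    by (metis card.empty p3_packing_def subset_empty)
qed

lemma p3_packing_number_le_star_game_value:
  "graph G \<Longrightarrow> p3_packing_number G \<le> 3 * star_game_value G"
proof (induction "card (verts G)" arbitrary: G rule: less_induct)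
  case less
  interpret graph G by (rule less.prems)
  show ?case
  proof (cases "p3_centers G = {}")
    case True
    then show ?thesis
      using p3_packing_number_no_centers[OF less.prems] by simp
  next
    case False
    then obtain v where v: "v \<in> p3_centers G"
      by auto
    \<comment> \<open>The left-hand side is the packing number divided by three, rounded up.\<close>
    have "(p3_packing_number G + 2) div 3 \<le> Suc (star_game_value (remove_p3 G c))"
      if c: "c \<in> p3_at G v" for c
    proof -
      have "verts (remove_p3 G c) \<subset> verts G"
        using v c by (auto simp: verts_remove_p3 p3_verts_def p3_centers_def p3_at_def)
      then have "p3_packing_number (remove_p3 G c) \<le> 3 * star_game_value (remove_p3 G c)"
        by (intro less.hyps graph_remove_p3 less.prems psubset_card_mono) auto
      then show ?thesis
        using p3_packing_number_remove_p3[OF less.prems c] by simp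
    qed
    then have "(p3_packing_number G + 2) div 3 \<le> star_game_value G"
      by (rule star_game_value_geI[OF less.prems v])
    then show ?thesis
      by simp
  qed
qed

section \<open>Graphs whose centers lie in a clique\<close>

text \<open>
  This is how Minimizer picks the two endpoints: \<open>N\<close> consists of the neighbours of the chosen
  center and \<open>A\<close> of the other clique vertices. If \<open>A\<close> has at least two elements, both endpoints
  come from \<open>A\<close>; otherwise the endpoints include all of \<open>A\<close>, and no clique vertex survives.
\<close>

lemma ex_pair_filling:
  assumes "finite N" "A \<subseteq> N" "2 \<le> card N"
  shows "\<exists>L \<subseteq> N. card L = 2 \<and> card (A - L) = card A - 2"
proof (cases "2 \<le> card A")
  case True
  then obtain L where L: "L \<subseteq> A" "card L = 2"
    using obtain_subset_with_card_n by metis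
  then have "card (A - L) = card A - 2"
    by (metis card_Diff_subset card.infinite finite_subset assms(1,2))
  then show ?thesis
    using L assms(2) by blast
next
  case False
  then obtain L where L: "A \<subseteq> L" "L \<subseteq> N" "card L = 2"
    using exists_subset_between[of A 2 N] assms by auto
  then have "card (A - L) = card A - 2"
    using False by (simp add: Diff_eq_empty_iff[THEN iffD2])
  then show ?thesis
    using L by blast
qed

text \<open>
  The hypotheses pass to the graph that remains after any round, with the removed vertices taken
  out of \<open>H\<close>. Minimizer's answer takes out three of them, or all if there are fewer.
\<close>

lemma star_game_value_le_clique:
  assumes "graph G" "finite H" "p3_centers G \<subseteq> H"
    "\<And>u w. u \<in> H \<Longrightarrow> w \<in> H \<Longrightarrow> u \<noteq> w \<Longrightarrow> u \<rightarrow>\<^bsub>G\<^esub> w"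
  shows "star_game_value G \<le> (card H + 2) div 3"
  using assms
proof (induction "card H" arbitrary: G H rule: less_induct)
  case less
  show ?case
  proof (rule star_game_value_leI[OF less.prems(1)])
    fix v assume v: "v \<in> p3_centers G"
    let ?N = "{w. v \<rightarrow>\<^bsub>G\<^esub> w}"
    have "v \<in> H"
      using v less.prems(3) by auto
    have fin: "finite ?N"
      using finite_out_neighbours[OF less.prems(1)] .
    obtain K where "K \<subseteq> ?N" "card K = 2"
      using v by (auto simp: p3_centers_def p3_at_def)
    then have "2 \<le> card ?N"
      using card_mono[OF fin] by metis
    then obtain L where L: "L \<subseteq> ?N" "card L = 2" "card (H - {v} - L) = card (H - {v}) - 2"
      using ex_pair_filling[OF fin, of "H - {v}"] less.prems(4) \<open>v \<in> H\<close> by blast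
    let ?c = "(v, L)" and ?H = "H - insert v L"
    have c: "?c \<in> p3_at G v"
      using L by (auto simp: p3_at_def)
    have "card H \<ge> 1"
      using \<open>v \<in> H\<close> less.prems(2) by (simp add: Suc_le_eq card_gt_0_iff) blast
    have "card ?H = card H - 3"
      using L(3) \<open>v \<in> H\<close> less.prems(2)
      by (simp add: Diff_insert2[of H v L])
    have "p3_centers (remove_p3 G ?c) \<subseteq> ?H"
      using less.prems(3) p3_centers_remove_p3[OF less.prems(1), of ?c]
      unfolding p3_verts_def fst_conv snd_conv by blast
    moreover have "u \<rightarrow>\<^bsub>remove_p3 G ?c\<^esub> w" if "u \<in> ?H" "w \<in> ?H" "u \<noteq> w" for u w
      using that less.prems(4)
      by (simp add: dominates_remove_p3[OF less.prems(1)] p3_verts_def)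
    moreover have "card ?H < card H" "finite ?H"
      using \<open>card ?H = card H - 3\<close> \<open>card H \<ge> 1\<close> less.prems(2) by simp_all
    ultimately have "star_game_value (remove_p3 G ?c) \<le> (card ?H + 2) div 3"
      using less.hyps[OF _ graph_remove_p3[OF less.prems(1)]] by metis
    then have "Suc (star_game_value (remove_p3 G ?c)) \<le> (card H + 2) div 3"
      using \<open>card ?H = card H - 3\<close> \<open>card H \<ge> 1\<close> by presburger
    then show "\<exists>c \<in> p3_at G v. Suc (star_game_value (remove_p3 G c)) \<le> (card H + 2) div 3"
      using c by blast
  qed
qed

text \<open>Disjoint copies have different centers.\<close>

lemma p3_packing_number_le_centers:
  assumes "graph G"
  shows "p3_packing_number G \<le> card (p3_centers G)"
proof -
  obtain P where P: "p3_packing G P" and card_P: "card P = p3_packing_number G"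
    using p3_packing_number_attained[OF assms] .
  have "inj_on fst P"
    by (rule inj_onI, rule p3_packingD[OF P]) (auto simp: p3_verts_def)
  moreover have "fst ` p3_copies G \<subseteq> p3_centers G"
    unfolding p3_copies_def p3_centers_def p3_at_def by (simp add: image_subset_iff)
  then have "fst ` P \<subseteq> p3_centers G"
    using P by (auto simp: p3_packing_def)
  ultimately have "card P \<le> card (p3_centers G)"
    by (rule card_inj_on_le) (rule finite_p3_centers[OF assms])
  then show ?thesis
    using card_P by simp
qed

section \<open>A clique with two leaves at every vertex\<close>

text \<open>The hubs are the numbers below \<open>m\<close>, and the leaves of hub \<open>i\<close> are \<open>m + i\<close> and \<open>2 * m + i\<close>.\<close>

definition leaf_of :: "nat \<Rightarrow> nat \<Rightarrow> nat \<Rightarrow> bool" where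
  "leaf_of m w i \<longleftrightarrow> i < m \<and> (w = m + i \<or> w = 2 * m + i)"

definition leafy_clique :: "nat \<Rightarrow> (nat, nat \<times> nat) pre_digraph" where
  "leafy_clique m =
    \<lparr>verts = {..<3 * m},
     arcs = {(u, w). u < m \<and> w < m \<and> u \<noteq> w \<or> leaf_of m w u \<or> leaf_of m u w},
     tail = fst, head = snd\<rparr>"

lemma dominates_leafy_clique:
  "u \<rightarrow>\<^bsub>leafy_clique m\<^esub> w \<longleftrightarrow> u < m \<and> w < m \<and> u \<noteq> w \<or> leaf_of m w u \<or> leaf_of m u w"
  by (auto simp: leafy_clique_def arcs_ends_def arc_to_ends_def)

lemma graph_leafy_clique: "graph (leafy_clique m)"
proof -
  let ?G = "leafy_clique m"
  have "arcs ?G \<subseteq> {..<3 * m} \<times> {..<3 * m}"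
    by (auto simp: leafy_clique_def leaf_of_def)
  then have "finite (arcs ?G)"
    by (rule finite_subset) simp
  moreover have "symmetric ?G"
    by (auto simp: symmetric_def sym_def dominates_leafy_clique)
  ultimately show ?thesis
    by unfold_locales
      (auto simp: leafy_clique_def leaf_of_def arc_to_ends_def symmetric_def)
qed

lemma p3_centers_leafy_clique: "p3_centers (leafy_clique m) \<subseteq> {..<m}"
proof
  fix v assume "v \<in> p3_centers (leafy_clique m)"
  then obtain L where L: "L \<subseteq> {w. v \<rightarrow>\<^bsub>leafy_clique m\<^esub> w}" "card L = 2"
    by (auto simp: p3_centers_def p3_at_def)
  then obtain x y where "v \<rightarrow>\<^bsub>leafy_clique m\<^esub> x" "v \<rightarrow>\<^bsub>leafy_clique m\<^esub> y" "x \<noteq> y"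
    by (auto simp: card_2_iff)
  then show "v \<in> {..<m}"
    by (auto simp: dominates_leafy_clique leaf_of_def)
qed

lemma p3_packing_number_leafy_clique: "p3_packing_number (leafy_clique m) = m"
proof (rule antisym)
  have "p3_packing_number (leafy_clique m) \<le> card (p3_centers (leafy_clique m))"
    by (rule p3_packing_number_le_centers[OF graph_leafy_clique])
  also have "\<dots> \<le> card {..<m}"
    by (intro card_mono p3_centers_leafy_clique) simp
  finally show "p3_packing_number (leafy_clique m) \<le> m"
    by simp
next
  define star where "star i = (i, {m + i, 2 * m + i})" for i
  have "star i \<in> p3_copies (leafy_clique m)" if "i < m" for i
  proof -
    have "i \<in> verts (leafy_clique m)"
      using that by (simp add: leafy_clique_def)
    moreover have "star i \<in> p3_at (leafy_clique m) i"
      using that by (auto simp: p3_at_def star_def dominates_leafy_clique leaf_of_def)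
    ultimately show ?thesis
      by (auto simp: p3_copies_def)
  qed
  moreover have "disjnt (p3_verts (star i)) (p3_verts (star j))" if "i < m" "j < m" "i \<noteq> j" for i j
    using that by (auto simp: star_def p3_verts_def disjnt_iff)
  ultimately have "p3_packing (leafy_clique m) (star ` {..<m})"
    unfolding p3_packing_def pairwise_def by auto
  then have "card (star ` {..<m}) \<le> p3_packing_number (leafy_clique m)"
    by (rule card_le_p3_packing_number[OF graph_leafy_clique])
  moreover have "card (star ` {..<m}) = m"
    by (subst card_image) (auto simp: inj_on_def star_def)
  ultimately show "m \<le> p3_packing_number (leafy_clique m)"
    by simp
qed

lemma star_game_value_leafy_clique: "star_game_value (leafy_clique m) \<le> (m + 2) div 3"
  using star_game_value_le_clique[OF graph_leafy_clique _ p3_centers_leafy_clique, of m]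
  by (simp add: dominates_leafy_clique)

theorem lemma5:
  shows "(\<forall>(G :: ('a, 'b) pre_digraph) m.
            graph G \<and> p3_packing_number G = m \<longrightarrow>
              int (star_game_value G) \<ge> \<lceil>real m / 3\<rceil>) \<and>
         (\<forall>m. \<exists>G :: (nat, nat \<times> nat) pre_digraph.
            graph G \<and> p3_packing_number G = m \<and>
              int (star_game_value G) = \<lceil>real m / 3\<rceil>)"
proof (intro conjI allI impI)
  fix G :: "('a, 'b) pre_digraph" and m
  assume "graph G \<and> p3_packing_number G = m"
  then show "int (star_game_value G) \<ge> \<lceil>real m / 3\<rceil>"
    using p3_packing_number_le_star_game_value[of G] by (auto simp: ceiling_le_iff)
next
  fix m
  let ?G = "leafy_clique m"
  have "m \<le> 3 * star_game_value ?G"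
    using p3_packing_number_le_star_game_value[OF graph_leafy_clique]
    by (simp add: p3_packing_number_leafy_clique)
  then have "int (star_game_value ?G) = \<lceil>real m / 3\<rceil>"
    using star_game_value_leafy_clique[of m] by linarith
  then show "\<exists>G :: (nat, nat \<times> nat) pre_digraph.
      graph G \<and> p3_packing_number G = m \<and> int (star_game_value G) = \<lceil>real m / 3\<rceil>"
    using graph_leafy_clique p3_packing_number_leafy_clique by blast
qed

end
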